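(* Let $L>0$ be such that $L^2$ is irrational. Then there are arbitrarily small $\sigma>0$ for which the Robin spectrum of the rectangle $[0,1]\times[0,L]$ with parameter $\sigma$ has multiplicities; that is, for every $\delta>0$ there are $\sigma\in(0,\delta)$ and pairs $(n,m)\ne(n',m')$ of non-negative integers with $\Lambda_{L;n,m}(\sigma)=\Lambda_{L;n',m'}(\sigma)$.
   Context: For an integer $n\ge 0$ and $\sigma>0$, $k_n(\sigma)$ denotes the unique solution $k\in(n\pi,(n+1)\pi)$ of the secular equation $\tan(k)=\frac{2\sigma k}{k^2-\sigma^2}$ (read in cross-multiplied form, $(k^2-\sigma^2)\sin k=2\sigma k\cos k$, when $k=\sigma$); set $k_n(0)=n\pi$. The Robin eigenvalues of the rectangle $[0,1]\times[0,L]$ (i.e. of $-\Delta f=\lambda f$ with $\frac{\partial f}{\partial n}+\sigma f=0$ on the boundary, $\frac{\partial}{\partial n}$ being the outward normal derivative) are $\Lambda_{L;n,m}(\sigma)=k_n(\sigma)^2+\frac1{L^2}k_m(\sigma L)^2$, $n,m\ge 0$, listed with multiplicity by the pairs $(n,m)$. *)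

theory Defs
  imports Complex_Main
begin

text \<open>The secular equation, which determines the Robin frequencies of the unit interval. The
  conjunct \<^term>\<open>cos k \<noteq> 0\<close> says that the tangent is defined; the case \<^term>\<open>k = \<sigma>\<close>, where the
  denominator vanishes, is read in cross-multiplied form.\<close>

definition secular :: "real \<Rightarrow> real \<Rightarrow> bool" where
  "secular \<sigma> k \<longleftrightarrow>
     (if k = \<sigma> then (k\<^sup>2 - \<sigma>\<^sup>2) * sin k = 2 * \<sigma> * k * cos k
      else cos k \<noteq> 0 \<and> tan k = 2 * \<sigma> * k / (k\<^sup>2 - \<sigma>\<^sup>2))"

text \<open>Only \<^term>\<open>\<sigma> \<ge> 0\<close> is meaningful; the description is justified by \<open>robin_k_ex1\<close> below.\<close>

definition robin_k :: "nat \<Rightarrow> real \<Rightarrow> real" where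
  "robin_k n \<sigma> =
     (if \<sigma> = 0 then real n * pi
      else (THE k. real n * pi < k \<and> k < (real n + 1) * pi \<and> secular \<sigma> k))"

definition robin_eigenvalue :: "real \<Rightarrow> nat \<Rightarrow> nat \<Rightarrow> real \<Rightarrow> real" where
  "robin_eigenvalue L n m \<sigma> = (robin_k n \<sigma>)\<^sup>2 + 1 / L\<^sup>2 * (robin_k m (\<sigma> * L))\<^sup>2"

lemma secular_cross_iff:
  assumes "0 < \<sigma>" "0 < k"
  shows "secular \<sigma> k \<longleftrightarrow> (k\<^sup>2 - \<sigma>\<^sup>2) * sin k = 2 * \<sigma> * k * cos k"
proof (cases "k = \<sigma>")
  case True
  then show ?thesis by (simp add: secular_def)
next
  case False
  have nz: "k\<^sup>2 - \<sigma>\<^sup>2 \<noteq> 0"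
    using assms False by (simp add: power2_eq_iff)
  show ?thesis
  proof (cases "cos k = 0")
    case True
    then have "sin k \<noteq> 0"
      using sin_cos_squared_add[of k] by auto
    with True False nz show ?thesis by (simp add: secular_def)
  next
    case c: False
    with False nz show ?thesis
      by (auto simp: secular_def tan_def field_simps)
  qed
qed

lemma secular_arctan_iff:
  assumes s: "0 < \<sigma>" and l: "real n * pi < k" and u: "k < (real n + 1) * pi"
  shows "secular \<sigma> k \<longleftrightarrow> k - 2 * arctan (\<sigma> / k) = real n * pi"
proof -
  have k: "0 < k"
    using l pi_gt_zero by (smt (verit) mult_nonneg_nonneg of_nat_0_le_iff)
  define t where "t = arctan (\<sigma> / k)"
  have t: "0 < t" "t < pi / 2"
    using s k arctan_ubound[of "\<sigma> / k"] by (auto simp: t_def)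
  have c: "cos t > 0"
    using t by (intro cos_gt_zero_pi) auto
  have tt: "sin t / cos t = \<sigma> / k"
    using tan_arctan[of "\<sigma> / k"] by (simp add: t_def tan_def)
  then have sg: "\<sigma> = k * sin t / cos t"
    using k by (simp add: field_simps)
  have "(k\<^sup>2 - \<sigma>\<^sup>2) * sin k - 2 * \<sigma> * k * cos k = (k / cos t)\<^sup>2 * sin (k - 2 * t)"
    unfolding sg sin_diff cos_double sin_double using c
    by (simp add: field_simps power2_eq_square)
  then have "secular \<sigma> k \<longleftrightarrow> (k / cos t)\<^sup>2 * sin (k - 2 * t) = 0"
    using secular_cross_iff[OF s k] by linarith
  also have "\<dots> \<longleftrightarrow> sin (k - 2 * t) = 0"
    using c k by simp
  also have "\<dots> \<longleftrightarrow> k - 2 * t = real n * pi"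
  proof
    assume "sin (k - 2 * t) = 0"
    then obtain i :: int where i: "k - 2 * t = of_int i * pi"
      by (auto simp: sin_zero_iff_int2)
    have "(real n - 1) * pi < of_int i * pi" "of_int i * pi < (real n + 1) * pi"
      using i t l u by (auto simp: algebra_simps)
    then have "real n - 1 < of_int i" "of_int i < real n + 1"
      by (simp_all add: mult_less_cancel_right)
    then have "i = int n" by linarith
    with i show "k - 2 * t = real n * pi" by simp
  qed simp
  finally show ?thesis by (simp add: t_def)
qed

lemma robin_k_ex1:
  assumes s: "0 < \<sigma>"
  shows "\<exists>!k. real n * pi < k \<and> k < (real n + 1) * pi \<and> secular \<sigma> k"
proof (rule ex_ex1I)
  define b where "b = (real n + 1) * pi"
  define a where "a = (if n = 0 then min (\<sigma> / 2) (pi / 2) else real n * pi)"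
  have b: "b > 0" by (simp add: b_def)
  have a: "0 < a" "real n * pi \<le> a" "a < b"
    using s pi_gt_zero by (auto simp: a_def b_def min_def algebra_simps)
  have lo: "a - 2 * arctan (\<sigma> / a) < real n * pi"
  proof (cases "n = 0")
    case True
    have "1 < \<sigma> / a" using True s a by (auto simp: a_def field_simps min_def)
    then have "pi / 4 < arctan (\<sigma> / a)"
      using arctan_less_iff[of 1 "\<sigma> / a"] by (simp add: arctan_one)
    moreover have "a \<le> pi / 2" using True by (simp add: a_def)
    ultimately show ?thesis using True by simp
  next
    case False
    with s a show ?thesis by (simp add: a_def)
  qed
  have hi: "real n * pi < b - 2 * arctan (\<sigma> / b)"
    using arctan_ubound[of "\<sigma> / b"] by (simp add: b_def algebra_simps)
  have "\<exists>x. a \<le> x \<and> x \<le> b \<and> x - 2 * arctan (\<sigma> / x) = real n * pi"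
    using a lo hi by (intro IVT') (auto intro!: continuous_intros)
  then obtain x where x: "a \<le> x" "x \<le> b" "x - 2 * arctan (\<sigma> / x) = real n * pi"
    by blast
  have "x \<noteq> b" using x(3) hi by auto
  then have xb: "x < (real n + 1) * pi" using x by (simp add: b_def)
  have "0 < arctan (\<sigma> / x)" using x(1) a s by simp
  then have "real n * pi < x" using x(3) by linarith
  then show "\<exists>k. real n * pi < k \<and> k < (real n + 1) * pi \<and> secular \<sigma> k"
    using xb secular_arctan_iff[OF s] x(3) by blast
next
  fix k l
  assume k: "real n * pi < k \<and> k < (real n + 1) * pi \<and> secular \<sigma> k"
    and l: "real n * pi < l \<and> l < (real n + 1) * pi \<and> secular \<sigma> l"
  have pos: "0 < k" "0 < l"
    using k l pi_gt_zero by (smt (verit) mult_nonneg_nonneg of_nat_0_le_iff)+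
  have eq: "k - 2 * arctan (\<sigma> / k) = real n * pi" "l - 2 * arctan (\<sigma> / l) = real n * pi"
    using k l secular_arctan_iff[OF s] by blast+
  have mono: "x - 2 * arctan (\<sigma> / x) < y - 2 * arctan (\<sigma> / y)" if "0 < x" "x < y" for x y
  proof -
    have "\<sigma> / y < \<sigma> / x" using that s by (simp add: field_simps)
    then have "arctan (\<sigma> / y) < arctan (\<sigma> / x)" by (simp add: arctan_less_iff)
    with that show ?thesis by linarith
  qed
  show "k = l"
    using mono[of k l] mono[of l k] pos eq by (cases k l rule: linorder_cases) auto
qed

end

theory Submission
  imports Defs "HOL-Analysis.Kronecker_Approximation_Theorem"
begin

text \<open>
  Why the theorem holds: for small \<open>\<sigma>\<close> every squared frequency \<open>k\<^sub>n\<^sup>2\<close> with \<open>n \<ge> 1\<close> moves up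
  by about \<open>4 \<sigma>\<close>, but \<open>k\<^sub>0\<^sup>2\<close> moves up by only about \<open>2 \<sigma>\<close>. So, of two eigenvalues
  \<open>\<Lambda>\<^sub>n\<^sub>,\<^sub>m\<close> and \<open>\<Lambda>\<^sub>n\<^sub>'\<^sub>,\<^sub>0\<close> with \<open>n, n', m\<close> positive, the former gains about
  \<open>2 \<sigma> / L\<close> on the latter. If it starts, at \<open>\<sigma> = 0\<close>, only slightly below the latter, then it has to
  overtake it at some small \<open>\<sigma>\<close>, and there the two coincide.

  Starting slightly below is a matter of number theory. For \<open>n = j - 1\<close> and \<open>n' = j + 1\<close> the
  difference at \<open>\<sigma> = 0\<close> is \<open>\<pi>\<^sup>2 (m\<^sup>2 / L\<^sup>2 - 4 j)\<close>, so with \<open>\<theta> = 1 / (4 L\<^sup>2)\<close>, which is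
  irrational, one needs \<open>m\<^sup>2 \<theta>\<close> to lie below an integer \<open>j\<close>, arbitrarily close to it. This is
  \<open>large_square_multiple_below_integer\<close>. It also makes \<open>m\<close>, and hence \<open>j\<close>, as large as desired, which
  is needed because the shift of \<open>k\<^sub>n\<^sup>2\<close> at a fixed \<open>\<sigma>\<close> comes close to \<open>4 \<sigma>\<close> only for large \<open>n\<close>
  (\<open>robin_shift_ge\<close>).

  The proof of the number-theoretic part avoids exponential sums. Let \<open>e\<close> be a limit, modulo one, of
  \<open>d\<^sup>2 \<theta>\<close> along integers \<open>d\<close> for which \<open>d \<theta>\<close> approaches an integer. If \<open>n\<close> realises such a limit
  approximately and \<open>d\<close> is then chosen with \<open>d \<theta>\<close> close enough to an integer in terms of \<open>n\<close>, then
  the cross term of \<open>(n + d)\<^sup>2 \<theta>\<close> is negligible modulo one; hence all multiples \<open>t e\<close> are limits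
  too, and by Dirichlet one of them is close to an integer. So \<open>n\<^sup>2 \<theta>\<close> can be brought close to an
  integer. If it exceeds the integer by a small \<open>x > 0\<close>, then multiplying \<open>n\<close> by the integer just
  below \<open>1 / \<surd>x\<close> moves it to the other side.
\<close>

section \<open>Squares times an irrational number, modulo one\<close>

lemma integer_multiple_near_integer:
  fixes \<theta> \<eta> :: real
  assumes "\<eta> > 0"
  obtains d :: nat and p :: int where "d > 0" "\<bar>d * \<theta> - p\<bar> < \<eta>"
proof -
  obtain N where N: "1 / real (Suc N) < \<eta>"
    using assms nat_approx_posE by blast
  obtain h k where "0 < k" and hk: "\<bar>of_int k * \<theta> - of_int h\<bar> < 1 / real (Suc N)"
    by (rule Dirichlet_approx[of "Suc N" \<theta>]) auto
  with N show ?thesis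
    by (intro that[of "nat k" h]) auto
qed

text \<open>The points \<open>e\<close> of the circle that are limits of \<open>d\<^sup>2 \<theta>\<close> along integers \<open>d > 0\<close> for which
  \<open>d \<theta>\<close> itself tends to an integer. The second requirement is what makes the set of these \<open>e\<close> closed
  under addition.\<close>

definition limit_of_squares_mod_1 :: "real \<Rightarrow> real \<Rightarrow> bool" where
  "limit_of_squares_mod_1 \<theta> e \<longleftrightarrow> (\<forall>\<eta>>0. \<exists>d::nat. d > 0 \<and>
        (\<exists>(p::int) (q::int). \<bar>d * \<theta> - p\<bar> < \<eta> \<and> \<bar>(real d)\<^sup>2 * \<theta> - (q + e)\<bar> < \<eta>))" for \<theta> e :: real

text \<open>Dirichlet's theorem supplies the integers \<open>d\<close>, and compactness of the unit interval the limit.\<close>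

lemma limit_of_squares_mod_1_exists:
  fixes \<theta> :: real
  obtains e where "limit_of_squares_mod_1 \<theta> e"
proof -
  have "\<exists>d::nat. d > 0 \<and> (\<exists>p::int. \<bar>d * \<theta> - p\<bar> < inverse (Suc i))" for i :: nat
    by (rule integer_multiple_near_integer[of "inverse (real (Suc i))" \<theta>]) auto
  then obtain d :: "nat \<Rightarrow> nat" where d: "\<And>i. d i > 0"
    and dp: "\<And>i. \<exists>p::int. \<bar>d i * \<theta> - p\<bar> < inverse (Suc i)"
    by metis
  have "\<forall>i. frac ((real (d i))\<^sup>2 * \<theta>) \<in> {0..1}"
    by (auto simp: frac_lt_1 less_imp_le)
  then obtain e r where r: "strict_mono r"
    and lim: "((\<lambda>i. frac ((real (d i))\<^sup>2 * \<theta>)) \<circ> r) \<longlonglongrightarrow> e"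
    using compact_Icc[of "0::real" 1] unfolding compact_def by metis
  show ?thesis
  proof (rule that[of e], unfold limit_of_squares_mod_1_def, intro allI impI)
    fix \<eta> :: real assume "\<eta> > 0"
    have "\<forall>\<^sub>F i in sequentially. dist (((\<lambda>i. frac ((real (d i))\<^sup>2 * \<theta>)) \<circ> r) i) e < \<eta>"
      using lim \<open>\<eta> > 0\<close> by (rule tendstoD)
    moreover have "\<forall>\<^sub>F i in sequentially. inverse (real (Suc i)) < \<eta>"
      using LIMSEQ_inverse_real_of_nat \<open>\<eta> > 0\<close> by (rule order_tendstoD)
    ultimately have "\<forall>\<^sub>F i in sequentially.
        dist (((\<lambda>i. frac ((real (d i))\<^sup>2 * \<theta>)) \<circ> r) i) e < \<eta> \<and> inverse (real (Suc i)) < \<eta>"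
      by (rule eventually_conj)
    then obtain i where i: "\<bar>frac ((real (d (r i)))\<^sup>2 * \<theta>) - e\<bar> < \<eta>" "inverse (real (Suc i)) < \<eta>"
      by (auto simp: dist_real_def dest: eventually_happens)
    have "inverse (real (Suc (r i))) \<le> inverse (real (Suc i))"
      using seq_suble[OF r, of i] by (simp add: field_simps)
    then obtain p :: int where "\<bar>d (r i) * \<theta> - p\<bar> < \<eta>"
      using dp[of "r i"] i(2) by (meson less_le_trans less_trans not_le)
    moreover have "\<bar>(real (d (r i)))\<^sup>2 * \<theta> - (\<lfloor>(real (d (r i)))\<^sup>2 * \<theta>\<rfloor> + e)\<bar> < \<eta>"
      using i(1) by (simp add: frac_def algebra_simps)
    ultimately show "\<exists>d::nat. d > 0 \<and>
        (\<exists>(p::int) (q::int). \<bar>d * \<theta> - p\<bar> < \<eta> \<and> \<bar>(real d)\<^sup>2 * \<theta> - (q + e)\<bar> < \<eta>)"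
      using d by blast
  qed
qed

text \<open>In \<open>(n + d)\<^sup>2 \<theta> = n\<^sup>2 \<theta> + d\<^sup>2 \<theta> + 2 n d \<theta>\<close> the last term is negligible modulo one as soon
  as \<open>d \<theta>\<close> is close to an integer compared with \<open>1 / n\<close>. So limits can be added.\<close>

lemma limit_of_squares_mod_1_multiple:
  fixes \<theta> e :: real and t :: nat
  assumes e: "limit_of_squares_mod_1 \<theta> e" and "t > 0"
  shows "limit_of_squares_mod_1 \<theta> (t * e)"
  using \<open>t > 0\<close>
proof (induction t rule: nat_induct_non_zero)
  case 1
  then show ?case using e by simp
next
  case (Suc t)
  show ?case unfolding limit_of_squares_mod_1_def
  proof (intro allI impI)
    fix \<eta> :: real assume "\<eta> > 0"
    then obtain n :: nat and p q :: int where n: "n > 0"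
      and p: "\<bar>n * \<theta> - p\<bar> < \<eta> / 4" and q: "\<bar>(real n)\<^sup>2 * \<theta> - (q + t * e)\<bar> < \<eta> / 4"
      using Suc.IH[unfolded limit_of_squares_mod_1_def, rule_format, of "\<eta> / 4"] by auto
    \<comment> \<open>The new step is chosen after \<open>n\<close>, so close to a period that the cross term \<open>2 n d \<theta>\<close> is
      harmless.\<close>
    obtain d :: nat and p' q' :: int where d: "d > 0"
      and p': "\<bar>d * \<theta> - p'\<bar> < \<eta> / (4 * n)" and q': "\<bar>(real d)\<^sup>2 * \<theta> - (q' + e)\<bar> < \<eta> / (4 * n)"
      using e[unfolded limit_of_squares_mod_1_def, rule_format, of "\<eta> / (4 * n)"] \<open>\<eta> > 0\<close> n by auto
    have small: "\<eta> / (4 * n) \<le> \<eta> / 4"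
      using n \<open>\<eta> > 0\<close> by (simp add: field_simps)
    have "\<bar>2 * n * (d * \<theta> - p')\<bar> = 2 * n * \<bar>d * \<theta> - p'\<bar>"
      by (simp add: abs_mult)
    also have "\<dots> < 2 * n * (\<eta> / (4 * n))"
      using n p' by (intro mult_strict_left_mono) auto
    also have "\<dots> = \<eta> / 2" using n by simp
    finally have cross: "\<bar>2 * n * (d * \<theta> - p')\<bar> < \<eta> / 2" .
    have split: "(real (n + d))\<^sup>2 * \<theta> - (real_of_int (q + q' + 2 * int n * p') + real (Suc t) * e)
        = ((real n)\<^sup>2 * \<theta> - (q + t * e)) + ((real d)\<^sup>2 * \<theta> - (q' + e)) + 2 * n * (d * \<theta> - p')"
      by (simp add: algebra_simps power2_eq_square)
    have "\<bar>(real (n + d))\<^sup>2 * \<theta> - (real_of_int (q + q' + 2 * int n * p') + real (Suc t) * e)\<bar> < \<eta>"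
      unfolding split using q q' small cross by linarith
    moreover have "\<bar>real (n + d) * \<theta> - real_of_int (p + p')\<bar> < \<eta>"
    proof -
      have "real (n + d) * \<theta> - real_of_int (p + p') = (n * \<theta> - p) + (d * \<theta> - p')"
        by (simp add: algebra_simps)
      then show ?thesis using p p' small \<open>\<eta> > 0\<close> by linarith
    qed
    ultimately show "\<exists>d::nat. d > 0 \<and>
          (\<exists>(p::int) (q::int). \<bar>d * \<theta> - p\<bar> < \<eta> \<and> \<bar>(real d)\<^sup>2 * \<theta> - (q + real (Suc t) * e)\<bar> < \<eta>)"
      using n by (metis add_gr_0)
  qed
qed

text \<open>By Dirichlet some multiple \<open>t e\<close> of a limit \<open>e\<close> is close to an integer, and \<open>t e\<close> is a limit
  itself.\<close>

lemma square_multiple_near_integer: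
  fixes \<theta> \<eta> :: real
  assumes "\<eta> > 0"
  obtains n :: nat and q :: int where "n > 0" "\<bar>(real n)\<^sup>2 * \<theta> - q\<bar> < \<eta>"
proof -
  obtain e where e: "limit_of_squares_mod_1 \<theta> e"
    by (rule limit_of_squares_mod_1_exists)
  obtain t :: nat and p :: int where t: "t > 0" and tp: "\<bar>t * e - p\<bar> < \<eta> / 2"
    by (rule integer_multiple_near_integer[of "\<eta> / 2" e]) (use assms in auto)
  have "\<eta> / 2 > 0" using assms by simp
  then obtain n :: nat and q :: int where n: "n > 0" and q: "\<bar>(real n)\<^sup>2 * \<theta> - (q + t * e)\<bar> < \<eta> / 2"
    using limit_of_squares_mod_1_multiple[OF e t] unfolding limit_of_squares_mod_1_def by blast
  have "\<bar>(real n)\<^sup>2 * \<theta> - real_of_int (q + p)\<bar> < \<eta>"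
    unfolding of_int_add using q tp by linarith
  with n show ?thesis by (rule that)
qed

text \<open>An approximation from above is turned into one from below by rescaling: \<open>n\<^sup>2 \<theta> = q + x\<close> gives
  \<open>(k n)\<^sup>2 \<theta> = k\<^sup>2 q + k\<^sup>2 x\<close>, and the squares \<open>k\<^sup>2 x\<close> reach \<open>1\<close> in steps of size at most
  about \<open>2 \<surd>x\<close>. Irrationality excludes equality.\<close>

lemma square_multiple_below_integer:
  fixes \<theta> \<eta> :: real
  assumes irr: "\<theta> \<notin> \<rat>" and \<eta>: "\<eta> > 0"
  obtains n :: nat and q :: int where "n > 0" "0 < q - (real n)\<^sup>2 * \<theta>" "q - (real n)\<^sup>2 * \<theta> < \<eta>"
proof -
  define z where "z = min \<eta> 1"
  have z: "0 < z" "z \<le> 1" "z \<le> \<eta>" using \<eta> by (auto simp: z_def)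
  obtain n :: nat and q :: int where n: "n > 0" and q: "\<bar>(real n)\<^sup>2 * \<theta> - q\<bar> < (z / 2)\<^sup>2"
    by (rule square_multiple_near_integer[of "(z / 2)\<^sup>2" \<theta>]) (use z in auto)
  define x where "x = (real n)\<^sup>2 * \<theta> - q"
  have "x \<noteq> 0"
  proof
    assume "x = 0"
    then have "\<theta> = q / n\<^sup>2" using n by (simp add: x_def field_simps)
    with irr show False by (simp add: Rats_divide)
  qed
  have "(z / 2)\<^sup>2 < z" using z by (simp add: power2_eq_square field_simps)
  show ?thesis
  proof (cases "x < 0")
    case True
    then show ?thesis
      using that[of n q] n q \<open>(z / 2)\<^sup>2 < z\<close> z unfolding x_def by linarith
  next
    case False
    then have x: "0 < x" "x < (z / 2)\<^sup>2" using \<open>x \<noteq> 0\<close> q by (auto simp: x_def)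
    define s where "s = sqrt x"
    have s: "0 < s" "s\<^sup>2 = x" "s < z / 2"
      using x z real_less_lsqrt[of "z / 2" x] by (auto simp: s_def)
    \<comment> \<open>With \<open>k\<close> just below \<open>1 / s\<close>, the overshoot \<open>k\<^sup>2 x\<close> falls just short of a full period.\<close>
    define k where "k = nat \<lfloor>1 / s\<rfloor>"
    have inv: "1 < 1 / s" using s z by (simp add: field_simps)
    then have "real k = of_int \<lfloor>1 / s\<rfloor>" using s by (simp add: k_def)
    then have k: "real k \<le> 1 / s" "1 / s - 1 < real k" by linarith+
    have ks: "k * s \<le> 1" "1 - s < k * s"
      using k s by (auto simp: field_simps)
    have "0 < k" using k inv by (auto intro: Nat.gr0I)
    have kx: "(real (k * n))\<^sup>2 * \<theta> = k\<^sup>2 * q + (k * s)\<^sup>2"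
    proof -
      have "(real (k * n))\<^sup>2 * \<theta> = k\<^sup>2 * (n\<^sup>2 * \<theta>)"
        by (simp add: power_mult_distrib)
      also have "\<dots> = k\<^sup>2 * (q + s\<^sup>2)" using s(2) by (simp add: x_def)
      finally show ?thesis by (simp add: power_mult_distrib algebra_simps)
    qed
    have "(k * s)\<^sup>2 \<le> 1" using ks s by (simp add: power_le_one)
    moreover have "1 - 2 * s < (k * s)\<^sup>2"
    proof -
      have "(1 - s)\<^sup>2 < (k * s)\<^sup>2"
        using ks s z by (intro power_strict_mono) auto
      moreover have "(1 - s)\<^sup>2 = 1 - 2 * s + s\<^sup>2" by (simp add: power2_diff)
      moreover have "0 < s\<^sup>2" unfolding s(2) by (rule x(1))
      ultimately show ?thesis by linarith
    qed
    moreover have "(k * s)\<^sup>2 \<noteq> 1"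
    proof
      assume "(k * s)\<^sup>2 = 1"
      then have "\<theta> = (k\<^sup>2 * q + 1) / (real (k * n))\<^sup>2"
        using kx n \<open>0 < k\<close> by (simp add: field_simps)
      then have "\<theta> \<in> \<rat>" by simp
      with irr show False by blast
    qed
    ultimately have "0 < (int k)\<^sup>2 * q + 1 - (real (k * n))\<^sup>2 * \<theta>" "(int k)\<^sup>2 * q + 1 - (real (k * n))\<^sup>2 * \<theta> < \<eta>"
      using kx s z by simp_all
    then show ?thesis
      using that[of "k * n" "(int k)\<^sup>2 * q + 1"] n \<open>0 < k\<close> by simp
  qed
qed

text \<open>Multiplying \<open>n\<close> by \<open>M\<close> makes it large, while the gap grows only by the factor \<open>M\<^sup>2\<close>, which
  does not depend on \<open>n\<close>.\<close>

lemma large_square_multiple_below_integer: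
  fixes \<theta> \<eta> :: real and M :: nat
  assumes irr: "\<theta> \<notin> \<rat>" and \<eta>: "\<eta> > 0" and M: "M > 0"
  obtains n :: nat and q :: int where "n \<ge> M" "0 < q - (real n)\<^sup>2 * \<theta>" "q - (real n)\<^sup>2 * \<theta> < \<eta>"
proof -
  obtain n :: nat and q :: int where n: "n > 0"
    and q: "0 < q - (real n)\<^sup>2 * \<theta>" "q - (real n)\<^sup>2 * \<theta> < \<eta> / M\<^sup>2"
    by (rule square_multiple_below_integer[OF irr, of "\<eta> / M\<^sup>2"]) (use \<eta> M in auto)
  have eq: "real_of_int ((int M)\<^sup>2 * q) - (real (M * n))\<^sup>2 * \<theta> = M\<^sup>2 * (q - (real n)\<^sup>2 * \<theta>)"
    by (simp add: power_mult_distrib algebra_simps)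
  show ?thesis
  proof (rule that)
    show "M \<le> M * n" using n by simp
    show "0 < real_of_int ((int M)\<^sup>2 * q) - (real (M * n))\<^sup>2 * \<theta>"
      unfolding eq using q(1) M by simp
    show "real_of_int ((int M)\<^sup>2 * q) - (real (M * n))\<^sup>2 * \<theta> < \<eta>"
      unfolding eq using q(2) M by (simp add: field_simps)
  qed
qed

section \<open>Robin frequencies of the interval\<close>

lemma robin_k_bounds:
  assumes "\<sigma> > 0"
  shows "real n * pi < robin_k n \<sigma>" "robin_k n \<sigma> < (real n + 1) * pi"
    and "robin_k n \<sigma> = real n * pi + 2 * arctan (\<sigma> / robin_k n \<sigma>)"
proof -
  have "real n * pi < robin_k n \<sigma> \<and> robin_k n \<sigma> < (real n + 1) * pi \<and> secular \<sigma> (robin_k n \<sigma>)"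
    using theI'[OF robin_k_ex1[OF assms, of n]] assms by (simp add: robin_k_def)
  then show "real n * pi < robin_k n \<sigma>" "robin_k n \<sigma> < (real n + 1) * pi"
    "robin_k n \<sigma> = real n * pi + 2 * arctan (\<sigma> / robin_k n \<sigma>)"
    using secular_arctan_iff[OF assms, of n "robin_k n \<sigma>"] by auto
qed

lemma robin_k_unique:
  assumes "\<sigma> > 0" "real n * pi < k" "k < (real n + 1) * pi"
    and "k = real n * pi + 2 * arctan (\<sigma> / k)"
  shows "robin_k n \<sigma> = k"
proof -
  have "secular \<sigma> k"
    using secular_arctan_iff[OF assms(1-3)] assms(4) by simp
  then show ?thesis
    using the1_equality[OF robin_k_ex1[OF assms(1)]] assms by (simp add: robin_k_def)
qed

lemma robin_k_pos: "\<sigma> > 0 \<Longrightarrow> robin_k n \<sigma> > 0"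
  using robin_k_bounds(1)[of \<sigma> n] by (smt (verit) mult_nonneg_nonneg of_nat_0_le_iff pi_gt_zero)

text \<open>As a function of the frequency \<open>k\<close> the parameter is explicit,
  \<open>\<sigma> = k tan ((k - n \<pi>) / 2)\<close>, so \<^term>\<open>robin_k n\<close> is continuous as the inverse of a continuous
  function.\<close>

lemma isCont_robin_k:
  assumes \<sigma>: "\<sigma> > 0"
  shows "isCont (robin_k n) \<sigma>"
proof -
  define f where "f = (\<lambda>k. k * tan ((k - real n * pi) / 2))"
  define x where "x = robin_k n \<sigma>"
  define a where "a = (real n * pi + x) / 2"
  define b where "b = (x + (real n + 1) * pi) / 2"
  have x: "real n * pi < x" "x < (real n + 1) * pi" "x = real n * pi + 2 * arctan (\<sigma> / x)" "x > 0"
    using robin_k_bounds[OF \<sigma>, of n] robin_k_pos[OF \<sigma>, of n] unfolding x_def by auto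
  have "(x - real n * pi) / 2 = arctan (\<sigma> / x)" using x(3) by simp
  then have fx: "f x = \<sigma>"
    unfolding f_def using x(4) by (simp add: tan_arctan)
  have "isCont (robin_k n) (f x)"
  proof (rule isCont_inverse_function2[where a = a and x = x and b = b and f = f])
    show "a < x" "x < b" using x by (auto simp: a_def b_def)
  next
    fix z assume "a \<le> z" "z \<le> b"
    then have z: "real n * pi < z" "z < (real n + 1) * pi"
      using x by (auto simp: a_def b_def)
    define y where "y = (z - real n * pi) / 2"
    have y: "0 < y" "y < pi / 2"
      using z by (auto simp: y_def algebra_simps)
    have zpos: "0 < z"
      using z(1) by (smt (verit) mult_nonneg_nonneg of_nat_0_le_iff pi_gt_zero)
    have fz: "f z = z * tan y" by (simp add: f_def y_def)
    show "robin_k n (f z) = z"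
    proof (rule robin_k_unique)
      show "0 < f z" unfolding fz using zpos y by (simp add: tan_gt_zero)
      have "arctan (f z / z) = y"
        unfolding fz using zpos y by (simp add: arctan_tan)
      then show "z = real n * pi + 2 * arctan (f z / z)"
        by (simp add: y_def)
    qed (use z in simp_all)
    have "cos ((z - real n * pi) / 2) \<noteq> 0"
      using cos_gt_zero_pi[of y] y by (simp add: y_def)
    then show "isCont f z"
      unfolding f_def by (intro continuous_intros) auto
  qed
  then show ?thesis by (simp add: fx)
qed

lemma isCont_robin_eigenvalue:
  assumes "L > 0" "\<sigma> > 0"
  shows "isCont (robin_eigenvalue L n m) \<sigma>"
proof -
  have "isCont (\<lambda>\<sigma>. robin_k m (\<sigma> * L)) \<sigma>"
    using assms by (intro isCont_o2[OF _ isCont_robin_k] continuous_intros) auto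
  then have "isCont (\<lambda>\<sigma>. (robin_k n \<sigma>)\<^sup>2 + 1 / L\<^sup>2 * (robin_k m (\<sigma> * L))\<^sup>2) \<sigma>"
    using isCont_robin_k[OF assms(2)] by (intro continuous_intros)
  then show ?thesis by (simp add: robin_eigenvalue_def[abs_def])
qed

text \<open>With \<open>t = arctan y\<close> this is the inequality \<open>sin (2 t) \<le> 2 t\<close>.\<close>

lemma arctan_lower_bound:
  fixes y :: real
  assumes "y \<ge> 0"
  shows "y / (1 + y\<^sup>2) \<le> arctan y"
proof -
  have pos: "0 < 1 + y\<^sup>2" by (simp add: add_pos_nonneg)
  have "y / (1 + y\<^sup>2) = sin (arctan y) * cos (arctan y)"
    unfolding sin_arctan cos_arctan using pos by (simp add: field_simps)
  also have "\<dots> = sin (2 * arctan y) / 2" by (simp add: sin_double)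
  also have "\<dots> \<le> arctan y"
    using sin_x_le_x[of "2 * arctan y"] assms by simp
  finally show ?thesis .
qed

definition robin_shift :: "nat \<Rightarrow> real \<Rightarrow> real" where
  "robin_shift n \<sigma> = (robin_k n \<sigma>)\<^sup>2 - (real n * pi)\<^sup>2"

lemma robin_shift_nonneg:
  assumes "\<sigma> > 0"
  shows "0 \<le> robin_shift n \<sigma>"
  using power_mono[of "real n * pi" "robin_k n \<sigma>" 2] robin_k_bounds(1)[OF assms, of n]
  by (simp add: robin_shift_def)

lemma robin_shift_eq:
  fixes \<sigma> :: real and n :: nat
  assumes "\<sigma> > 0"
  defines "k \<equiv> robin_k n \<sigma>"
  shows "robin_shift n \<sigma> = 4 * (k * arctan (\<sigma> / k)) - 4 * (arctan (\<sigma> / k))\<^sup>2"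
proof -
  have "real n * pi = k - 2 * arctan (\<sigma> / k)"
    using robin_k_bounds(3)[OF assms(1), of n] unfolding k_def by linarith
  then show ?thesis
    unfolding robin_shift_def k_def[symmetric]
    by (simp only: power2_eq_square) (simp add: algebra_simps)
qed

lemma robin_k_times_arctan_le:
  assumes "\<sigma> > 0"
  shows "robin_k n \<sigma> * arctan (\<sigma> / robin_k n \<sigma>) \<le> \<sigma>"
proof -
  have "robin_k n \<sigma> * arctan (\<sigma> / robin_k n \<sigma>) \<le> robin_k n \<sigma> * (\<sigma> / robin_k n \<sigma>)"
    using robin_k_pos[OF assms, of n] assms
    by (intro mult_left_mono arctan_le_self) auto
  then show ?thesis using robin_k_pos[OF assms, of n] by simp
qed

lemma robin_shift_le:
  assumes "\<sigma> > 0"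
  shows "robin_shift n \<sigma> \<le> 4 * \<sigma>"
  using robin_shift_eq[OF assms, of n] robin_k_times_arctan_le[OF assms, of n]
    zero_le_power2[of "arctan (\<sigma> / robin_k n \<sigma>)"] by linarith

text \<open>For \<open>n = 0\<close> the frequency itself is \<open>2 arctan (\<sigma> / k)\<close>, so the square of the arc tangent cancels
  half of the main term of \<open>robin_shift_eq\<close>. This halved shift is what makes eigenvalues cross.\<close>

lemma robin_shift_0_le:
  assumes "\<sigma> > 0"
  shows "robin_shift 0 \<sigma> \<le> 2 * \<sigma>"
proof -
  define k where "k = robin_k 0 \<sigma>"
  have "k = 2 * arctan (\<sigma> / k)"
    using robin_k_bounds(3)[OF assms, of 0] by (simp add: k_def)
  then have "robin_shift 0 \<sigma> = 2 * (k * arctan (\<sigma> / k))"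
    unfolding robin_shift_def k_def[symmetric] by (simp add: power2_eq_square)
  then show ?thesis
    using robin_k_times_arctan_le[OF assms, of 0] by (simp add: k_def)
qed

text \<open>For fixed \<open>\<sigma>\<close> the bound \<open>robin_shift_le\<close> becomes sharp as \<open>n\<close> grows: both the error
  \<open>\<sigma> - k arctan (\<sigma> / k)\<close> and the square of the arc tangent are \<open>O(1 / k\<^sup>2)\<close>. They are bounded
  through \<open>k\<^sup>2 \<ge> n\<close>, which is crude but keeps the bound linear in \<open>1 / n\<close>.\<close>

lemma robin_shift_ge:
  assumes \<sigma>: "\<sigma> > 0" and n: "n > 0"
  shows "4 * \<sigma> - 4 * \<sigma>\<^sup>2 * (1 + \<sigma>) / n \<le> robin_shift n \<sigma>"
proof -
  define k where "k = robin_k n \<sigma>"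
  have "real n * 1 \<le> real n * pi"
    using pi_ge_two by (intro mult_left_mono) auto
  then have kn: "real n \<le> k" "0 < k"
    using robin_k_bounds(1)[OF \<sigma>, of n] robin_k_pos[OF \<sigma>, of n] unfolding k_def by linarith+
  have "real n * 1 \<le> k * k" using kn n by (intro mult_mono) auto
  then have nk: "real n \<le> k\<^sup>2" by (simp add: power2_eq_square)
  have "arctan (\<sigma> / k) \<le> \<sigma> / k" "0 \<le> arctan (\<sigma> / k)"
    using \<sigma> kn by (auto intro: arctan_le_self)
  then have sq: "(arctan (\<sigma> / k))\<^sup>2 \<le> \<sigma>\<^sup>2 / k\<^sup>2"
    by (metis power_mono power_divide)
  have pos: "0 < k\<^sup>2 + \<sigma>\<^sup>2" using kn by (simp add: add_pos_nonneg)
  have "k * ((\<sigma> / k) / (1 + (\<sigma> / k)\<^sup>2)) \<le> k * arctan (\<sigma> / k)"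
    using kn \<sigma> by (intro mult_left_mono arctan_lower_bound) auto
  moreover have "k * ((\<sigma> / k) / (1 + (\<sigma> / k)\<^sup>2)) = \<sigma> * k\<^sup>2 / (k\<^sup>2 + \<sigma>\<^sup>2)"
    using kn by (simp add: power2_eq_square field_simps)
  moreover have "\<sigma> * k\<^sup>2 / (k\<^sup>2 + \<sigma>\<^sup>2) = \<sigma> - \<sigma> ^ 3 / (k\<^sup>2 + \<sigma>\<^sup>2)"
  proof -
    have "\<sigma> * k\<^sup>2 = \<sigma> * (k\<^sup>2 + \<sigma>\<^sup>2) - \<sigma> ^ 3"
      by (simp add: algebra_simps power2_eq_square power3_eq_cube)
    then show ?thesis using pos by (simp add: diff_divide_distrib)
  qed
  moreover have "\<sigma> ^ 3 / (k\<^sup>2 + \<sigma>\<^sup>2) \<le> \<sigma> ^ 3 / k\<^sup>2"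
    using kn \<sigma> by (intro divide_left_mono) (auto simp: pos)
  ultimately have "\<sigma> - \<sigma> ^ 3 / k\<^sup>2 \<le> k * arctan (\<sigma> / k)" by linarith
  with sq have "4 * \<sigma> - 4 * (\<sigma> ^ 3 / k\<^sup>2 + \<sigma>\<^sup>2 / k\<^sup>2) \<le> robin_shift n \<sigma>"
    using robin_shift_eq[OF \<sigma>, of n] by (simp add: k_def)
  moreover have "\<sigma> ^ 3 / k\<^sup>2 + \<sigma>\<^sup>2 / k\<^sup>2 = \<sigma>\<^sup>2 * (1 + \<sigma>) / k\<^sup>2"
    by (simp add: add_divide_distrib[symmetric] algebra_simps power2_eq_square power3_eq_cube)
  moreover have "\<sigma>\<^sup>2 * (1 + \<sigma>) / k\<^sup>2 \<le> \<sigma>\<^sup>2 * (1 + \<sigma>) / n"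
    using nk n \<sigma> kn by (intro divide_left_mono) auto
  ultimately show ?thesis by simp
qed

section \<open>Crossing eigenvalues\<close>

theorem theorem1p2:
  fixes L :: real
  assumes "L > 0" and "L\<^sup>2 \<notin> \<rat>"
  shows "\<forall>\<delta>>0. \<exists>\<sigma>. 0 < \<sigma> \<and> \<sigma> < \<delta> \<and>
    (\<exists>n m n' m'. (n, m) \<noteq> (n', m') \<and>
       robin_eigenvalue L n m \<sigma> = robin_eigenvalue L n' m' \<sigma>)"
proof (intro allI impI)
  fix \<delta> :: real assume "\<delta> > 0"
  note L = \<open>L > 0\<close>
  define s where "s = \<delta> / 2"
  have s: "0 < s" "s < \<delta>" using \<open>\<delta> > 0\<close> by (auto simp: s_def)
  define \<theta> where "\<theta> = 1 / (4 * L\<^sup>2)"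
  have \<theta>pos: "\<theta> > 0" using L by (simp add: \<theta>_def)
  have irr: "\<theta> \<notin> \<rat>"
  proof
    assume "\<theta> \<in> \<rat>"
    then have "1 / (4 * \<theta>) \<in> \<rat>" by simp
    then show False using assms by (simp add: \<theta>_def)
  qed
  \<comment> \<open>At \<open>\<sigma> = s\<close> the gain is at least \<open>2 s / L\<close> up to three losses: the initial gap, at most
    \<open>4 \<pi>\<^sup>2 \<epsilon>\<close>, and the deficits \<open>C / n\<close> and \<open>D / (m L\<^sup>2)\<close> of the shifts. The choices of
    \<open>\<epsilon>\<close>, \<open>R\<close> and \<open>M\<close> bound them by \<open>s / (2 L)\<close>, \<open>s / (2 L)\<close> and \<open>s / L\<close>.\<close>
  define C where "C = 4 * s\<^sup>2 * (1 + s)"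
  define D where "D = 4 * (s * L)\<^sup>2 * (1 + s * L)"
  have CD: "0 < C" "0 < D" using s L by (simp_all add: C_def D_def add_pos_pos)
  define \<epsilon> where "\<epsilon> = s / (8 * L * pi\<^sup>2)"
  have \<epsilon>: "\<epsilon> > 0" "4 * pi\<^sup>2 * \<epsilon> = s / (2 * L)" using s L by (auto simp: \<epsilon>_def)
  define R where "R = 2 * L * C / s"
  \<comment> \<open>The integer \<open>j\<close> just above \<open>m\<^sup>2 \<theta>\<close> then exceeds \<open>R + 1\<close>, so that \<open>n = j - 1\<close>
    exceeds \<open>R\<close>.\<close>
  obtain M :: nat where M: "real M > max (D / (s * L)) ((R + 1) / \<theta>)"
    using reals_Archimedean2 by blast
  have "R > 0" using CD s L by (simp add: R_def)
  have "0 < (R + 1) / \<theta>" using \<open>R > 0\<close> \<theta>pos by simp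
  then have "M > 0" using M by (auto intro: Nat.gr0I)
  obtain m :: nat and j :: int where m: "m \<ge> M"
    and j: "0 < j - (real m)\<^sup>2 * \<theta>" "j - (real m)\<^sup>2 * \<theta> < \<epsilon>"
    by (rule large_square_multiple_below_integer[OF irr \<epsilon>(1) \<open>M > 0\<close>])
  have m0: "m > 0" using m \<open>M > 0\<close> by simp
  have mD: "D / (s * L) < m" and mR: "(R + 1) / \<theta> < m" using M m by auto
  have "R + 1 < m * \<theta>" using mR \<theta>pos by (simp add: field_simps)
  also have "\<dots> \<le> (real m)\<^sup>2 * \<theta>"
    using m0 \<theta>pos by (intro mult_right_mono) (auto simp: power2_eq_square)
  finally have jR: "R + 1 < j" using j by linarith
  define n where "n = nat (j - 1)"
  define n' where "n' = nat (j + 1)"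
  have n: "real n = j - 1" "real n' = j + 1" "n > 0"
    using jR \<open>R > 0\<close> by (auto simp: n_def n'_def)
  define \<eta> where "\<eta> = j - (real m)\<^sup>2 * \<theta>"
  define F where "F = (\<lambda>\<sigma>. robin_eigenvalue L n m \<sigma> - robin_eigenvalue L n' 0 \<sigma>)"
  have F: "F \<sigma> = - 4 * pi\<^sup>2 * \<eta> + robin_shift n \<sigma> - robin_shift n' \<sigma>
      + (robin_shift m (\<sigma> * L) - robin_shift 0 (\<sigma> * L)) / L\<^sup>2" for \<sigma>
    unfolding F_def robin_eigenvalue_def robin_shift_def \<eta>_def n \<theta>_def
    using L by (simp add: field_simps power2_eq_square)
  have "0 \<le> F s"
  proof -
    have "C / n \<le> s / (2 * L)"
    proof -
      have "2 * L * C / s < n" using n(1) jR by (simp add: R_def)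
      then show ?thesis using s L n(3) by (simp add: field_simps)
    qed
    moreover have "4 * s - C / n \<le> robin_shift n s"
      using robin_shift_ge[OF s(1) n(3)] by (simp add: C_def)
    moreover have "robin_shift n' s \<le> 4 * s" by (rule robin_shift_le[OF s(1)])
    moreover have "4 * pi\<^sup>2 * \<eta> \<le> s / (2 * L)"
      unfolding \<epsilon>(2)[symmetric] using j(2) by (simp add: \<eta>_def)
    moreover have "s / L \<le> (robin_shift m (s * L) - robin_shift 0 (s * L)) / L\<^sup>2"
    proof -
      have sL: "0 < s * L" using s L by simp
      have "D / m \<le> s * L" using mD m0 s L CD by (simp add: field_simps)
      moreover have "4 * (s * L) - D / m \<le> robin_shift m (s * L)"
        using robin_shift_ge[OF sL m0] by (simp add: D_def)
      moreover note robin_shift_0_le[OF sL]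
      ultimately have "s * L \<le> robin_shift m (s * L) - robin_shift 0 (s * L)" by linarith
      then have "s * L / L\<^sup>2 \<le> (robin_shift m (s * L) - robin_shift 0 (s * L)) / L\<^sup>2"
        by (rule divide_right_mono) simp
      then show ?thesis using L by (simp add: power2_eq_square)
    qed
    moreover have "s / (2 * L) + s / (2 * L) = s / L" by simp
    ultimately show ?thesis unfolding F by linarith
  qed
  have \<eta>: "\<eta> > 0" using j(1) by (simp add: \<eta>_def)
  \<comment> \<open>Near \<open>\<sigma> = 0\<close> the initial gap \<open>4 \<pi>\<^sup>2 \<eta>\<close> dominates: the upper eigenvalue moves up, and the lower
    one by at most \<open>4 \<sigma> + 4 \<sigma> / L\<close>, which at \<open>\<sigma> = r\<close> is within the gap.\<close>
  define r where "r = min s (pi\<^sup>2 * \<eta> / (1 + 1 / L))"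
  have Lp: "0 < 1 + 1 / L" using L by (simp add: add_pos_pos)
  have r: "0 < r" "r \<le> s" using s \<eta> Lp by (auto simp: r_def)
  have "F r \<le> 0"
  proof -
    have "r * (1 + 1 / L) \<le> pi\<^sup>2 * \<eta>"
      using Lp by (simp add: r_def pos_le_divide_eq[symmetric])
    moreover have "r * (1 + 1 / L) = r + r / L" by (simp add: algebra_simps)
    ultimately have "4 * r + 4 * r / L \<le> 4 * pi\<^sup>2 * \<eta>" by simp
    moreover have rL: "0 < r * L" using r L by simp
    have "(robin_shift m (r * L) - robin_shift 0 (r * L)) / L\<^sup>2 \<le> 4 * (r * L) / L\<^sup>2"
      using robin_shift_le[OF rL, of m] robin_shift_nonneg[OF rL, of 0]
      by (intro divide_right_mono) auto
    moreover have "4 * (r * L) / L\<^sup>2 = 4 * r / L" using L by (simp add: power2_eq_square)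
    moreover note robin_shift_le[OF r(1), of n] robin_shift_nonneg[OF r(1), of n']
    ultimately show ?thesis unfolding F by linarith
  qed
  moreover have "continuous_on {r..s} F"
    unfolding F_def using r L
    by (intro continuous_at_imp_continuous_on ballI continuous_diff isCont_robin_eigenvalue) auto
  ultimately obtain \<sigma> where \<sigma>: "r \<le> \<sigma>" "\<sigma> \<le> s" "F \<sigma> = 0"
    using IVT'[of F r 0 s] \<open>0 \<le> F s\<close> r by blast
  have "0 < \<sigma>" "\<sigma> < \<delta>" using \<sigma> r s by linarith+
  moreover have "(n, m) \<noteq> (n', 0)" using m0 by simp
  moreover have "robin_eigenvalue L n m \<sigma> = robin_eigenvalue L n' 0 \<sigma>"
    using \<sigma>(3) by (simp add: F_def)
  ultimately show "\<exists>\<sigma>. 0 < \<sigma> \<and> \<sigma> < \<delta> \<and>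
    (\<exists>n m n' m'. (n, m) \<noteq> (n', m') \<and>
       robin_eigenvalue L n m \<sigma> = robin_eigenvalue L n' m' \<sigma>)"
    by blast
qed

end
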